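(* Let $H$ be a non-empty non-crossing ordered perfect matching. Then $g_H(n)=\Omega(n^{1/d})$, where $d=\mathrm{depth}(H)$.
   Context: An ordered graph is a graph with a total order on its vertices. For a graph $G$ with a Hamiltonian path $P=v_1,\dots,v_n$, $(G,P)$ contains the ordered graph $H$ (order $u_1,\dots,u_k$) as a pattern if there exist $1\le a_1<\dots<a_k\le n$ such that every edge $u_iu_j$ of $H$ maps to an edge $v_{a_i}v_{a_j}$ of $G-E(P)$; otherwise $(G,P)$ avoids $H$. $g_H(n)$ is the maximum integer $t$ such that for every graph $G$ with a Hamiltonian path $P$ on $n$ vertices, if $(G,P)$ avoids $H$ then $G$ contains an induced path on at least $t$ vertices. An ordered perfect matching is an ordered 1-regular graph; it is non-crossing if there are no $a<b<c<d$ with edges $u_au_c$ and $u_bu_d$. Depth of a non-crossing ordered perfect matching $C=u_1,\dots,u_k$: if $C$ is empty, $\mathrm{depth}(C)=0$; otherwise let $u_1u_i$ be the edge at $u_1$, let $A$ be the ordered subgraph induced by $u_2,\dots,u_{i-1}$ and $B$ the ordered subgraph induced by $u_{i+1},\dots,u_k$ (both non-crossing ordered perfect matchings), and set $\mathrm{depth}(C)=\max\{\mathrm{depth}(A)+1,\mathrm{depth}(B)\}$. *)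

theory Defs
  imports
    "Graph_Theory.Digraph_Component"
    "Graph_Theory.Vertex_Walk"
    "HOL-Library.Landau_Symbols"
begin

text \<open>
  A finite simple graph is a digraph in the locale \<^locale>\<open>graph\<close>: finite, loop-free, without
  parallel arcs, and symmetric, so that each undirected edge is a pair of opposite arcs.
  An ordered graph is such a graph whose vertex type is linearly ordered; the total order on its
  vertices is the one inherited from the type.
\<close>

text \<open>The edges of a path, each in both orientations, to match \<^const>\<open>arcs_ends\<close>.\<close>

definition path_edges :: "'a list \<Rightarrow> ('a \<times> 'a) set" where
  "path_edges p = set (vwalk_arcs p) \<union> (set (vwalk_arcs p))\<inverse>"

definition hamiltonian_path :: "('a, 'b) pre_digraph \<Rightarrow> 'a list \<Rightarrow> bool" where
  "hamiltonian_path G p \<longleftrightarrow> vpath p G \<and> set p = verts G"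

definition induced_path :: "('a, 'b) pre_digraph \<Rightarrow> 'a list \<Rightarrow> bool" where
  "induced_path G q \<longleftrightarrow> vpath q G \<and> arcs_ends (G \<restriction> set q) = path_edges q"

text \<open>
  The map \<open>f\<close> sends the vertex \<open>u\<^sub>i\<close> to the (0-based) position \<open>a\<^sub>i\<close>
  on the path.
\<close>

definition contains_pattern ::
  "('a, 'b) pre_digraph \<Rightarrow> 'a list \<Rightarrow> ('c::linorder, 'd) pre_digraph \<Rightarrow> bool" where
  "contains_pattern G p H \<longleftrightarrow>
     (\<exists>f. strict_mono_on (verts H) f \<and> f ` verts H \<subseteq> {..<length p} \<and>
          (\<forall>u v. u \<rightarrow>\<^bsub>H\<^esub> v \<longrightarrow> (p ! f u, p ! f v) \<in> arcs_ends G - path_edges p))"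

text \<open>
  Vertices of the graphs \<open>G\<close> are natural numbers, which loses nothing since every finite graph is
  isomorphic to one of these. If \<open>H\<close> has a vertex of positive degree and \<open>n > 0\<close>, the
  maximum exists: a graph that is itself a path on \<open>n\<close> vertices avoids \<open>H\<close>. For \<open>n = 0\<close> there
  is no graph to consider (a path has at least one vertex) and the value is unspecified.
\<close>

definition g :: "('c::linorder, 'd) pre_digraph \<Rightarrow> nat \<Rightarrow> nat" where
  "g H n = (GREATEST t. \<forall>(G :: (nat, nat \<times> nat) pre_digraph) p.
     graph G \<and> hamiltonian_path G p \<and> card (verts G) = n \<and> \<not> contains_pattern G p H \<longrightarrow>
     (\<exists>q. induced_path G q \<and> length q \<ge> t))"

definition perfect_matching :: "('a, 'b) pre_digraph \<Rightarrow> bool" where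
  "perfect_matching H \<longleftrightarrow> graph H \<and> (\<forall>v \<in> verts H. out_degree H v = 1)"

definition non_crossing :: "('a::linorder, 'b) pre_digraph \<Rightarrow> bool" where
  "non_crossing H \<longleftrightarrow>
     \<not> (\<exists>a b c d. a < b \<and> b < c \<and> c < d \<and> a \<rightarrow>\<^bsub>H\<^esub> c \<and> b \<rightarrow>\<^bsub>H\<^esub> d)"

text \<open>
  Meaningful for non-crossing perfect matchings only. There \<open>u < w\<close>, so removing \<open>u\<close> in the second
  recursive call changes nothing; it and the finiteness test serve to make the function total.
\<close>

function depth :: "('a::linorder, 'b) pre_digraph \<Rightarrow> nat" where
  "depth C =
     (if infinite (verts C) \<or> verts C = {} then 0
      else let u = Min (verts C); w = (THE w. u \<rightarrow>\<^bsub>C\<^esub> w) in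
        max (depth (C \<restriction> {x \<in> verts C. u < x \<and> x < w}) + 1)
            (depth (C \<restriction> {x \<in> verts C - {u}. w < x})))"
  by pat_completeness auto
termination
proof (relation "measure (\<lambda>C. card (verts C))")
  fix C :: "('a, 'b) pre_digraph" and u w
  assume "\<not> (infinite (verts C) \<or> verts C = {})" and "u = Min (verts C)"
  then have fin: "finite (verts C)" and u: "u \<in> verts C" by auto
  have "{x \<in> verts C. u < x \<and> x < w} \<subset> verts C" using u by auto
  from psubset_card_mono[OF fin this]
  show "(C \<restriction> {x \<in> verts C. u < x \<and> x < w}, C) \<in> measure (\<lambda>C. card (verts C))" by simp
  have "{x \<in> verts C - {u}. w < x} \<subset> verts C" using u by auto
  from psubset_card_mono[OF fin this]
  show "(C \<restriction> {x \<in> verts C - {u}. w < x}, C) \<in> measure (\<lambda>C. card (verts C))" by simp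
qed simp

declare depth.simps [simp del]

end

theory Submission
  imports Defs
begin

text \<open>
  Suppose that a stretch of the path avoids \<open>H\<close>, which is an edge over \<open>A\<close> followed by \<open>B\<close>. Cut the
  stretch in half. Either the second half avoids \<open>B\<close>, or the first half avoids the edge over \<open>A\<close>.
  In the latter case the part of the path below each chord avoids \<open>A\<close>, so if every induced path has
  at most \<open>t\<close> vertices then all chords have length \<open>O(t ^ depth A)\<close>; a shortest walk between
  the two ends of the half is an induced path, and its at most \<open>t\<close> steps cover the whole half, which
  has therefore \<open>O(t ^ (depth A + 1))\<close> vertices. The induction ends at the empty pattern, which
  cannot be avoided.
\<close>

section \<open>Shortest walks\<close>

lemma set_vwalk_arcs_conv_nth:
  "set (vwalk_arcs q) = {(q ! i, q ! Suc i) |i. Suc i < length q}"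
proof (induction q rule: vwalk_arcs.induct)
  case (3 x y xs)
  have "{((x # y # xs) ! i, (x # y # xs) ! Suc i) |i. Suc i < length (x # y # xs)} =
      insert (x, y) {((y # xs) ! i, (y # xs) ! Suc i) |i. Suc i < length (y # xs)}" (is "?L = ?R")
  proof (intro equalityI subsetI)
    fix e assume "e \<in> ?L"
    then obtain i where "e = ((x # y # xs) ! i, (x # y # xs) ! Suc i)" "Suc i < length (x # y # xs)"
      by blast
    then show "e \<in> ?R" by (cases i) auto
  next
    fix e assume "e \<in> ?R"
    then consider "e = (x, y)" |
      i where "e = ((y # xs) ! i, (y # xs) ! Suc i)" "Suc i < length (y # xs)"
      by blast
    then show "e \<in> ?L"
    proof cases
      case 1 then show ?thesis by (auto intro!: exI[of _ 0])
    next
      case 2 then show ?thesis by (auto intro!: exI[of _ "Suc i"])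
    qed
  qed
  with 3 show ?case by simp
qed auto

section \<open>Adjacency in graphs and induced subgraphs\<close>

lemma arcs_ends_induce_subgraph:
  "arcs_ends (G \<restriction> S) = {(u, v). u \<rightarrow>\<^bsub>G\<^esub> v \<and> u \<in> S \<and> v \<in> S}"
  by (auto simp: arcs_ends_conv)

lemma graph_arcs_ends_sym: "graph G \<Longrightarrow> u \<rightarrow>\<^bsub>G\<^esub> v \<Longrightarrow> v \<rightarrow>\<^bsub>G\<^esub> u"
  using arcs_ends_symmetric sym_digraph.sym_arcs
  by (metis graph.axioms(2) pseudo_graph.axioms(2))

lemma graph_arcs_ends_irrefl: "graph G \<Longrightarrow> \<not> u \<rightarrow>\<^bsub>G\<^esub> u"
  using loopfree_digraph.adj_not_same digraph.axioms(2) graph.axioms(1) by metis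

lemma graph_arcs_ends_verts:
  assumes "graph G" "u \<rightarrow>\<^bsub>G\<^esub> v"
  shows "u \<in> verts G" "v \<in> verts G"
proof -
  interpret graph G by fact
  show "u \<in> verts G" "v \<in> verts G" using adj_in_verts[OF assms(2)] by auto
qed

section \<open>Cutting walks short\<close>

lemma vwalk_take: "vwalk q G \<Longrightarrow> n > 0 \<Longrightarrow> vwalk (take n q) G"
  using set_vwalk_arcs_append1[of "take n q" "drop n q"]
  by (auto simp: vwalk_def dest: in_set_takeD)

lemma vwalk_shortcut:
  assumes "vwalk q G" "i < j" "j < length q" "q ! i \<rightarrow>\<^bsub>G\<^esub> q ! j"
  shows "vwalk (take (Suc i) q @ drop j q) G"
proof -
  have ne: "take (Suc i) q \<noteq> []" "drop j q \<noteq> []" using assms by auto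
  have "last (take (Suc i) q) = q ! i"
    using assms by (simp add: take_Suc_conv_app_nth)
  moreover have "hd (drop j q) = q ! j"
    using assms by (simp add: hd_drop_conv_nth)
  ultimately have "set (vwalk_arcs (take (Suc i) q @ drop j q)) \<subseteq> arcs_ends G"
    using assms set_vwalk_arcs_append1[of "take (Suc i) q" "drop (Suc i) q"]
      set_vwalk_arcs_append2[of "drop j q" "take j q"]
    by (auto simp: vwalk_arcs_append[OF ne] vwalk_def)
  then show ?thesis
    using assms ne by (auto simp: vwalk_def dest: in_set_takeD in_set_dropD)
qed

text \<open>A chord or a repeated vertex would give a shorter walk between the same ends. Every such
  shortcut uses only vertices of \<open>q\<close>, so minimality among walks inside
  \<open>set q\<close> suffices; this lets the lemma be applied to walks confined to a stretch of a
  path.\<close>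

lemma shortest_walk_induced:
  assumes G: "graph G" and q: "vwalk q G"
    and min: "\<And>q'. vwalk q' G \<Longrightarrow> set q' \<subseteq> set q \<Longrightarrow> hd q' = hd q \<Longrightarrow> last q' = last q
      \<Longrightarrow> length q \<le> length q'"
  shows "induced_path G q"
proof -
  have short: "j = Suc i" if "i < j" "j < length q" "q ! i \<rightarrow>\<^bsub>G\<^esub> q ! j" for i j
  proof -
    have "length q \<le> length (take (Suc i) q @ drop j q)"
    proof (rule min)
      show "vwalk (take (Suc i) q @ drop j q) G" using vwalk_shortcut[OF q that] .
    qed (use that in \<open>auto dest: in_set_takeD in_set_dropD simp: hd_append\<close>)
    then show ?thesis using that by simp
  qed
  have no_repeat: "q ! i \<noteq> q ! j" if "i < j" "j < length q" for i j
  proof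
    assume eq: "q ! i = q ! j"
    show False
    \<comment> \<open>If \<open>j\<close> is not last, the arc leaving \<open>q ! j\<close> also
      leaves \<open>q ! i\<close> and is a chord to \<open>Suc j\<close>. If \<open>j\<close> is
      last, the prefix up to \<open>i\<close> already ends at \<open>last q\<close>.\<close>
    proof (cases "Suc j < length q")
      case True
      then have "q ! j \<rightarrow>\<^bsub>G\<^esub> q ! Suc j"
        using q by (auto simp: vwalk_def set_vwalk_arcs_conv_nth)
      then show False using short[of i "Suc j"] eq that True by simp
    next
      case False
      have "last (take (Suc i) q) = last q"
      proof -
        have "j = length q - 1" using False that by simp
        then show ?thesis
          using that eq by (cases "q = []") (auto simp: take_Suc_conv_app_nth last_conv_nth)
      qed
      moreover have "vwalk (take (Suc i) q) G" using vwalk_take[OF q] by simp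
      ultimately have "length q \<le> length (take (Suc i) q)"
        by (intro min) (auto dest: in_set_takeD)
      then show False using that by simp
    qed
  qed
  then have "distinct q"
    unfolding distinct_conv_nth by (metis nat_neq_iff)
  moreover have "arcs_ends (G \<restriction> set q) \<subseteq> path_edges q"
  proof
    fix e assume "e \<in> arcs_ends (G \<restriction> set q)"
    then obtain i j where e: "e = (q ! i, q ! j)" "i < length q" "j < length q"
        and adj: "q ! i \<rightarrow>\<^bsub>G\<^esub> q ! j"
      by (auto simp: arcs_ends_induce_subgraph in_set_conv_nth)
    then have "i \<noteq> j" using graph_arcs_ends_irrefl[OF G] by auto
    then have "j = Suc i \<or> i = Suc j"
      using short[of i j] short[of j i] adj graph_arcs_ends_sym[OF G adj] e
      by (metis nat_neq_iff)
    then show "e \<in> path_edges q"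
      using e by (auto simp: path_edges_def set_vwalk_arcs_conv_nth)
  qed
  moreover have "path_edges q \<subseteq> arcs_ends (G \<restriction> set q)"
  proof
    fix e assume "e \<in> path_edges q"
    then obtain i where "Suc i < length q" "e = (q ! i, q ! Suc i) \<or> e = (q ! Suc i, q ! i)"
      by (auto simp: path_edges_def set_vwalk_arcs_conv_nth)
    moreover from this have "q ! i \<rightarrow>\<^bsub>G\<^esub> q ! Suc i"
      using q by (auto simp: vwalk_def set_vwalk_arcs_conv_nth)
    ultimately show "e \<in> arcs_ends (G \<restriction> set q)"
      using graph_arcs_ends_sym[OF G] by (auto simp: arcs_ends_induce_subgraph)
  qed
  ultimately show ?thesis
    using q by (auto simp: induced_path_def vpath_def)
qed

text \<open>Ensures that every bound on the lengths of induced paths is at least 1.\<close>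

lemma induced_path_singleton:
  assumes "graph G" "v \<in> verts G"
  shows "induced_path G [v]"
  using assms by (intro shortest_walk_induced) (auto simp: vwalk_def Suc_le_eq)

text \<open>A shortest walk inside the interval between its two ends is induced, hence has at most
  \<open>t - 1\<close> steps, and each step advances the position by at most \<open>s\<close>. The
  assumption on arcs includes the edges of \<open>p\<close> itself.\<close>

lemma short_chords_interval_bound:
  assumes G: "graph G" and p: "vpath p G" and "l < h" "h \<le> length p"
    and t: "\<And>q. induced_path G q \<Longrightarrow> length q \<le> t"
    and s: "\<And>i j. l \<le> i \<Longrightarrow> i < j \<Longrightarrow> j < h \<Longrightarrow> p ! i \<rightarrow>\<^bsub>G\<^esub> p ! j \<Longrightarrow> j \<le> i + s"
  shows "h - l \<le> 1 + (t - 1) * s"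
proof -
  define S where "S = (!) p ` {l..<h}"
  \<comment> \<open>The walks are confined to \<open>S\<close> because arcs leaving the interval may
    be long. Any competitor with vertices in \<open>set q\<close> and the same ends again satisfies
    \<open>W\<close>.\<close>
  define W where "W q \<longleftrightarrow> vwalk q G \<and> set q \<subseteq> S \<and> hd q = p ! l \<and> last q = p ! (h - 1)" for q
  have "W (map ((!) p) [l..<h])"
    unfolding W_def vwalk_def
  proof (intro conjI)
    show "set (vwalk_arcs (map ((!) p) [l..<h])) \<subseteq> arcs_ends G"
    proof -
      have "p ! i \<rightarrow>\<^bsub>G\<^esub> p ! Suc i" if "Suc i < length p" for i
        using p that by (auto simp: set_vwalk_arcs_conv_nth vpath_def vwalk_def)
      then show ?thesis
        using \<open>h \<le> length p\<close> by (auto simp: set_vwalk_arcs_conv_nth)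
    qed
    show "set (map ((!) p) [l..<h]) \<subseteq> verts G"
      using p \<open>h \<le> length p\<close> by (auto simp: vpath_def vwalk_def)
  qed (use \<open>l < h\<close> in \<open>auto simp: S_def hd_map last_map\<close>)
  then obtain q where q: "W q" and min: "\<And>q'. W q' \<Longrightarrow> length q \<le> length q'"
    using ex_has_least_nat[of W _ length] by blast
  then have "induced_path G q"
    by (intro shortest_walk_induced[OF G]) (auto simp: W_def)
  with t have len: "length q \<le> t" by blast
  \<comment> \<open>Induction on the number \<open>k\<close> of steps; a step backwards only lowers
    the position.\<close>
  have "\<exists>a. l \<le> a \<and> a < h \<and> a \<le> l + k * s \<and> q ! k = p ! a" if "k < length q" for k
    using that
  proof (induction k)
    case 0
    have "q ! 0 = p ! l" using q 0 by (simp add: W_def hd_conv_nth)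
    then show ?case using \<open>l < h\<close> by auto
  next
    case (Suc k)
    then obtain a where a: "l \<le> a" "a < h" "a \<le> l + k * s" "q ! k = p ! a" by auto
    have "q ! Suc k \<in> S" using q Suc.prems by (auto simp: W_def)
    then obtain b where b: "l \<le> b" "b < h" "q ! Suc k = p ! b" by (auto simp: S_def)
    have "q ! k \<rightarrow>\<^bsub>G\<^esub> q ! Suc k"
      using q Suc.prems by (auto simp: W_def vwalk_def set_vwalk_arcs_conv_nth)
    then have "b \<le> a + s"
      using s[of a b] a b by (cases "a < b") auto
    then show ?case using a b by (intro exI[of _ b]) auto
  qed
  moreover have "q \<noteq> []" using q by (auto simp: W_def vwalk_def)
  ultimately obtain a where a: "a < h" "a \<le> l + (length q - 1) * s" "q ! (length q - 1) = p ! a"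
    by (metis diff_less length_greater_0_conv less_one)
  then have "p ! a = p ! (h - 1)"
    using q \<open>q \<noteq> []\<close> by (simp add: W_def last_conv_nth)
  then have "a = h - 1"
    using p a \<open>h \<le> length p\<close> by (auto simp: vpath_def nth_eq_iff_index_eq)
  moreover have "(length q - 1) * s \<le> (t - 1) * s" using len by (intro mult_right_mono) auto
  ultimately show ?thesis using a \<open>l < h\<close> by linarith
qed

section \<open>Decomposing a non-crossing perfect matching\<close>

lemma graph_induce_subgraph:
  assumes "graph G" "S \<subseteq> verts G"
  shows "graph (G \<restriction> S)"
proof -
  interpret graph G by fact
  have "symmetric (G \<restriction> S)"
    using graph_arcs_ends_sym[OF \<open>graph G\<close>]
    by (auto simp: symmetric_def sym_def arcs_ends_induce_subgraph)
  then show ?thesis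
    using assms(2) finite_subset[OF assms(2)] no_loops no_multi_arcs
    by unfold_locales (auto simp: arc_to_ends_def)
qed

text \<open>If \<open>S\<close> contains the partner of each of its vertices, no out-arc at a vertex
  of \<open>S\<close> is lost.\<close>

lemma perfect_matching_induce_subgraph:
  assumes "perfect_matching H" "S \<subseteq> verts H" "\<And>u v. u \<rightarrow>\<^bsub>H\<^esub> v \<Longrightarrow> u \<in> S \<Longrightarrow> v \<in> S"
  shows "perfect_matching (H \<restriction> S)"
proof -
  have "out_arcs (H \<restriction> S) v = out_arcs H v" if "v \<in> S" for v
  proof -
    have "head H e \<in> S" if "e \<in> arcs H" "tail H e = v" for e
      using assms(3)[of v "head H e"] \<open>v \<in> S\<close> that by (auto simp: arcs_ends_conv)
    then show ?thesis using \<open>v \<in> S\<close> by auto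
  qed
  then show ?thesis
    using assms graph_induce_subgraph
    by (auto simp: perfect_matching_def out_degree_def subset_iff)
qed

text \<open>Makes the definite description in \<open>depth\<close> denote the partner of
  \<open>u\<close>.\<close>

lemma perfect_matching_ex1:
  assumes "perfect_matching H" "u \<in> verts H"
  shows "\<exists>!w. u \<rightarrow>\<^bsub>H\<^esub> w"
proof -
  obtain e where "out_arcs H u = {e}"
    using assms by (auto simp: perfect_matching_def out_degree_def card_1_singleton_iff)
  then have "u \<rightarrow>\<^bsub>H\<^esub> w \<longleftrightarrow> w = head H e" for w
    by (auto simp: arcs_ends_conv out_arcs_def set_eq_iff)
  then show ?thesis by simp
qed

lemma non_crossing_induce_subgraph: "non_crossing H \<Longrightarrow> non_crossing (H \<restriction> S)"
  by (auto simp: non_crossing_def arcs_ends_induce_subgraph)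

text \<open>An arc meeting \<open>u\<close> or \<open>w\<close> is the first edge, since partners
  are unique. Any other arc lies to the right of \<open>u\<close>, and straddling \<open>w\<close>
  would make it cross the first edge; so it lies in the block below that edge or in the block after
  it.\<close>

lemma non_crossing_matching_arc_cases:
  assumes H: "perfect_matching H" "non_crossing H"
    and uw: "u = Min (verts H)" "u \<rightarrow>\<^bsub>H\<^esub> w" and xy: "x \<rightarrow>\<^bsub>H\<^esub> y"
  obtains "x = u" "y = w" | "x = w" "y = u"
    | "u < x" "x < w" "u < y" "y < w" | "u < x" "w < x" "u < y" "w < y"
proof -
  have G: "graph H" using H by (simp add: perfect_matching_def)
  interpret graph H by fact
  note sym = graph_arcs_ends_sym[OF G]
  have V: "u \<in> verts H" "w \<in> verts H" "x \<in> verts H" "y \<in> verts H"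
    using graph_arcs_ends_verts[OF G] uw(2) xy by auto
  have ge: "u \<le> x" "u \<le> y" "u \<le> w" using V uw(1) by auto
  have ex1: "b = c" if "a \<rightarrow>\<^bsub>H\<^esub> b" "a \<rightarrow>\<^bsub>H\<^esub> c" for a b c
    using perfect_matching_ex1[OF H(1), of a] graph_arcs_ends_verts[OF G] that by blast
  have nc: "\<not> (u < a \<and> a < w \<and> w < b)" if "a \<rightarrow>\<^bsub>H\<^esub> b" for a b
    using H(2) uw(2) that by (auto simp: non_crossing_def)
  show ?thesis
  proof (cases "x \<in> {u, w} \<or> y \<in> {u, w}")
    case True
    then show ?thesis
      using that(1,2) ex1[OF uw(2)] ex1[OF sym[OF uw(2)]] xy sym[OF xy] by blast
  next
    case False
    then show ?thesis
      using that(3,4) ge nc[OF xy] nc[OF sym[OF xy]] by (auto simp: order.order_iff_strict)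
  qed
qed

section \<open>The bound\<close>

text \<open>Only the admissible positions shrink, while \<open>G\<close>, \<open>p\<close> and the
  excluded edges stay those of the whole path. The induction can thus pass to intervals without
  forming subgraphs.\<close>

definition contains_between ::
  "('a, 'b) pre_digraph \<Rightarrow> 'a list \<Rightarrow> nat \<Rightarrow> nat \<Rightarrow> ('c::linorder, 'd) pre_digraph \<Rightarrow> bool" where
  "contains_between G p l h H \<longleftrightarrow>
     (\<exists>f. strict_mono_on (verts H) f \<and> f ` verts H \<subseteq> {l..<h} \<and>
          (\<forall>u v. u \<rightarrow>\<^bsub>H\<^esub> v \<longrightarrow> (p ! f u, p ! f v) \<in> arcs_ends G - path_edges p))"

lemma contains_pattern_conv_between:
  "contains_pattern G p H \<longleftrightarrow> contains_between G p 0 (length p) H"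
  by (simp add: contains_pattern_def contains_between_def lessThan_atLeast0)

text \<open>The first edge goes to the chord at \<open>i\<close>, \<open>j\<close>, the block below
  it to positions strictly between, and the rest to positions from \<open>m\<close> on. No arc of
  \<open>H\<close> joins two of these three pieces, so no further chord is required.\<close>

lemma contains_between_combine:
  assumes H: "perfect_matching H" "non_crossing H" and G: "graph G"
    and uw: "u = Min (verts H)" "u \<rightarrow>\<^bsub>H\<^esub> w"
    and A: "contains_between G p (Suc i) j (H \<restriction> {x \<in> verts H. u < x \<and> x < w})"
    and B: "contains_between G p m h (H \<restriction> {x \<in> verts H - {u}. w < x})"
    and ij: "l \<le> i" "i < j" "j < m" "m \<le> h" "(p ! i, p ! j) \<in> arcs_ends G - path_edges p"
  shows "contains_between G p l h H"
proof -
  let ?A = "{x \<in> verts H. u < x \<and> x < w}" and ?B = "{x \<in> verts H - {u}. w < x}"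
  have gH: "graph H" using H by (simp add: perfect_matching_def)
  interpret graph H by fact
  have V: "u \<in> verts H" "w \<in> verts H" and "u \<noteq> w"
    using graph_arcs_ends_verts[OF gH uw(2)] graph_arcs_ends_irrefl[OF gH] uw(2) by auto
  then have "u < w" using uw(1) by (simp add: order.not_eq_order_implies_strict)
  have min: "u \<le> x" if "x \<in> verts H" for x using that uw(1) by simp
  obtain f where f: "strict_mono_on ?A f" "f ` ?A \<subseteq> {Suc i..<j}"
      "\<And>x y. x \<rightarrow>\<^bsub>H\<^esub> y \<Longrightarrow> x \<in> ?A \<Longrightarrow> y \<in> ?A \<Longrightarrow> (p ! f x, p ! f y) \<in> arcs_ends G - path_edges p"
    using A unfolding contains_between_def arcs_ends_induce_subgraph induce_subgraph_verts by blast
  obtain f' where f': "strict_mono_on ?B f'" "f' ` ?B \<subseteq> {m..<h}"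
      "\<And>x y. x \<rightarrow>\<^bsub>H\<^esub> y \<Longrightarrow> x \<in> ?B \<Longrightarrow> y \<in> ?B \<Longrightarrow> (p ! f' x, p ! f' y) \<in> arcs_ends G - path_edges p"
    using B unfolding contains_between_def arcs_ends_induce_subgraph induce_subgraph_verts by blast
  have fA: "i < f x" "f x < j" if "x \<in> ?A" for x using f(2) that by force+
  have fB: "m \<le> f' x" "f' x < h" if "x \<in> ?B" for x using f'(2) that by force+
  define F where "F x = (if x = u then i else if x < w then f x else if x = w then j else f' x)" for x
  have FA: "F x = f x" if "x \<in> ?A" for x using that by (auto simp: F_def)
  have FB: "F x = f' x" if "x \<in> ?B" for x using that by (auto simp: F_def)
  have Fu: "F u = i" and Fw: "F w = j" using \<open>u < w\<close> by (auto simp: F_def)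
  have split: "x = u \<or> x = w \<or> x \<in> ?A \<or> x \<in> ?B" if "x \<in> verts H" for x
    using min[OF that] that by force
  have sym: "(p ! j, p ! i) \<in> arcs_ends G - path_edges p"
    using ij(5) graph_arcs_ends_sym[OF G] by (auto simp: path_edges_def)
  have "strict_mono_on (verts H) F"
  proof (rule strict_mono_onI)
    fix x y assume xy: "x \<in> verts H" "y \<in> verts H" "x < y"
    \<comment> \<open>The order \<open>u\<close>, first block, \<open>w\<close>, second block leaves
      exactly these placements of \<open>x < y\<close>.\<close>
    consider "x = u" "y = w" | "x = u" "y \<in> ?A" | "x = u" "y \<in> ?B" | "x = w" "y \<in> ?B"
      | "x \<in> ?A" "y = w" | "x \<in> ?A" "y \<in> ?A" | "x \<in> ?A" "y \<in> ?B" | "x \<in> ?B" "y \<in> ?B"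
      using split[OF xy(1)] split[OF xy(2)] xy(3) \<open>u < w\<close> by (elim disjE) auto
    then show "F x < F y"
    proof cases
      case 1 then show ?thesis using Fu Fw ij by simp
    next
      case 2 then show ?thesis using Fu FA fA by simp
    next
      case 3 then show ?thesis using Fu FB fB[of y] ij by simp
    next
      case 4 then show ?thesis using Fw FB fB[of y] ij by simp
    next
      case 5 then show ?thesis using Fw FA fA by simp
    next
      case 6 then show ?thesis using FA f(1) xy(3) by (simp add: strict_mono_on_def)
    next
      case 7 then show ?thesis using FA FB fA[of x] fB[of y] ij by simp
    next
      case 8 then show ?thesis using FB f'(1) xy(3) by (simp add: strict_mono_on_def)
    qed
  qed
  moreover have "F ` verts H \<subseteq> {l..<h}"
  proof
    fix z assume "z \<in> F ` verts H"
    then obtain x where x: "z = F x" "x \<in> verts H" by blast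
    from split[OF x(2)] show "z \<in> {l..<h}"
    proof (elim disjE)
      assume "x = u" then show ?thesis using x Fu ij by simp
    next
      assume "x = w" then show ?thesis using x Fw ij by simp
    next
      assume "x \<in> ?A" then show ?thesis using x FA fA[of x] ij by simp
    next
      assume "x \<in> ?B" then show ?thesis using x FB fB[of x] ij by simp
    qed
  qed
  moreover have "(p ! F x, p ! F y) \<in> arcs_ends G - path_edges p" if xy: "x \<rightarrow>\<^bsub>H\<^esub> y" for x y
    using H uw xy
  proof (cases rule: non_crossing_matching_arc_cases)
    case 1 then show ?thesis using Fu Fw ij by simp
  next
    case 2 then show ?thesis using Fu Fw sym by simp
  next
    case 3
    then have "x \<in> ?A" "y \<in> ?A" using graph_arcs_ends_verts[OF gH xy] by auto
    then show ?thesis using FA f(3)[OF xy] by simp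
  next
    case 4
    then have "x \<in> ?B" "y \<in> ?B" using graph_arcs_ends_verts[OF gH xy] by auto
    then show ?thesis using FB f'(3)[OF xy] by simp
  qed
  ultimately show ?thesis unfolding contains_between_def by blast
qed

lemma contains_between_empty: "graph H \<Longrightarrow> verts H = {} \<Longrightarrow> contains_between G p l h H"
  using graph_arcs_ends_verts[of H] by (auto simp: contains_between_def)

text \<open>Quantifying over all intervals makes this an induction hypothesis usable below each
  chord and on the second half, with the same \<open>G\<close> and \<open>t\<close>.\<close>

definition avoidance_bound ::
  "('c::linorder, 'd) pre_digraph \<Rightarrow> nat \<Rightarrow> ('a, 'b) pre_digraph \<Rightarrow> bool" where
  "avoidance_bound H K G \<longleftrightarrow> (\<forall>p l h t. vpath p G \<longrightarrow> h \<le> length p \<longrightarrow>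
     (\<forall>q. induced_path G q \<longrightarrow> length q \<le> t) \<longrightarrow> \<not> contains_between G p l h H \<longrightarrow>
     h - l \<le> K * t ^ depth H)"

text \<open>Induction along the recursion of \<open>depth\<close>. Passing from \<open>A\<close> to
  the edge over \<open>A\<close> costs one factor of \<open>t\<close>, matching the
  \<open>+ 1\<close> in the first branch; halving costs only a constant. \<open>K\<close> is chosen
  before \<open>G\<close>.\<close>

lemma avoidance_bound_exists:
  fixes H :: "('c::linorder, 'd) pre_digraph"
  assumes "perfect_matching H" "non_crossing H"
  shows "\<exists>K. \<forall>G :: ('a, 'b) pre_digraph. graph G \<longrightarrow> avoidance_bound H K G"
  using assms
proof (induction H rule: depth.induct)
  case (1 H)
  have gH: "graph H" using 1 by (simp add: perfect_matching_def)
  interpret H: graph H by fact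
  show ?case
  proof (cases "verts H = {}")
    case True
    then show ?thesis
      by (simp add: avoidance_bound_def contains_between_empty[OF gH])
  next
    case False
    define u where "u = Min (verts H)"
    have "u \<in> verts H" using False by (simp add: u_def)
    then obtain w where uw: "u \<rightarrow>\<^bsub>H\<^esub> w" and w: "(THE w. u \<rightarrow>\<^bsub>H\<^esub> w) = w"
      using perfect_matching_ex1[OF "1.prems"(1)] by (metis theI')
    note cases = non_crossing_matching_arc_cases[OF "1.prems" u_def uw]
    define A where "A = H \<restriction> {x \<in> verts H. u < x \<and> x < w}"
    define B where "B = H \<restriction> {x \<in> verts H - {u}. w < x}"
    \<comment> \<open>By the four arc cases, an arc starting in one of the blocks also ends
      there.\<close>
    have AB: "perfect_matching A" "perfect_matching B"
      unfolding A_def B_def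
      by (rule perfect_matching_induce_subgraph[OF "1.prems"(1)];
          use graph_arcs_ends_verts[OF gH] in \<open>auto elim: cases\<close>)+
    have nc: "non_crossing A" "non_crossing B"
      unfolding A_def B_def by (rule non_crossing_induce_subgraph[OF "1.prems"(2)])+
    have depth: "depth H = max (depth A + 1) (depth B)"
      using False by (subst depth.simps) (simp add: Let_def A_def B_def u_def[symmetric] w)
    obtain KA where KA: "\<And>G :: ('a, 'b) pre_digraph. graph G \<Longrightarrow> avoidance_bound A KA G"
      using "1.IH"(1)[OF _ u_def w[symmetric]] False AB nc unfolding A_def by auto
    obtain KB where KB: "\<And>G :: ('a, 'b) pre_digraph. graph G \<Longrightarrow> avoidance_bound B KB G"
      using "1.IH"(2)[OF _ u_def w[symmetric]] False AB nc unfolding B_def by auto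
    \<comment> \<open>\<open>KA + 1 + KB\<close> serves both cases for a half. The factor 2 restores
      the whole interval, and the last 1 pays for rounding the midpoint.\<close>
    define K where "K = 2 * (KA + 1 + KB) + 1"
    have "avoidance_bound H K G" if G: "graph G" for G :: "('a, 'b) pre_digraph"
      unfolding avoidance_bound_def
    proof (intro allI impI)
      fix p l h t
      assume p: "vpath p G" and h: "h \<le> length p" and t: "\<forall>q. induced_path G q \<longrightarrow> length q \<le> t"
        and avoid: "\<not> contains_between G p l h H"
      have "hd p \<in> verts G" using p by (auto simp: vpath_def vwalk_def)
      from induced_path_singleton[OF G this] t have "t \<ge> 1" by fastforce
      then have power: "t ^ a \<le> t ^ depth H" if "a \<le> depth H" for a
        using that by (simp add: power_increasing)
      define m where "m = (l + h) div 2"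
      \<comment> \<open>The two cases bound different halves, hence the minimum.\<close>
      have half: "min (m - l) (h - m) \<le> (KA + 1 + KB) * t ^ depth H" if "l < m"
      proof (cases "contains_between G p m h B")
        case False
        then have "h - m \<le> KB * t ^ depth B"
          using KB[OF G] p h t unfolding avoidance_bound_def by blast
        also have "\<dots> \<le> (KA + 1 + KB) * t ^ depth H"
          using power[of "depth B"] depth by (intro mult_mono) auto
        finally show ?thesis by simp
      next
        case True
        have m: "m \<le> h" using that by (auto simp: m_def)
        \<comment> \<open>The part below a chord starts at \<open>Suc i\<close>, so a chord is one
          longer than the bound for \<open>A\<close>; the same \<open>+ 1\<close> accommodates path
          edges.\<close>
        have "m - l \<le> 1 + (t - 1) * (KA * t ^ depth A + 1)"
        proof (rule short_chords_interval_bound[OF G p that])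
          fix i j
          assume ij: "l \<le> i" "i < j" "j < m" and adj: "p ! i \<rightarrow>\<^bsub>G\<^esub> p ! j"
          show "j \<le> i + (KA * t ^ depth A + 1)"
          proof (cases "(p ! i, p ! j) \<in> path_edges p")
            case True
            then have "j = Suc i \<or> i = Suc j"
              using p ij m h
              by (auto simp: path_edges_def set_vwalk_arcs_conv_nth vpath_def nth_eq_iff_index_eq)
            then show ?thesis using ij by simp
          next
            case False
            \<comment> \<open>Otherwise the chord, a copy of \<open>A\<close> below it and the copy
              of \<open>B\<close> in the second half would form \<open>H\<close>.\<close>
            then have "\<not> contains_between G p (Suc i) j A"
              using contains_between_combine[OF "1.prems" G u_def uw, of p i j m h l]
                avoid True ij m adj unfolding A_def B_def by blast
            moreover have "j \<le> length p" using ij m h by simp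
            ultimately have "j - Suc i \<le> KA * t ^ depth A"
              using KA[OF G] p t unfolding avoidance_bound_def by blast
            then show ?thesis by simp
          qed
        qed (use m h t in auto)
        also have "\<dots> \<le> (KA + 1 + KB) * t ^ (depth A + 1)"
        proof -
          have "1 + (t - 1) * (KA * t ^ depth A + 1) = t + (t - 1) * (KA * t ^ depth A)"
            using \<open>t \<ge> 1\<close> by (cases t) simp_all
          also have "\<dots> \<le> t + t * (KA * t ^ depth A)"
            by (intro add_left_mono mult_right_mono) auto
          also have "\<dots> \<le> t ^ (depth A + 1) + t * (KA * t ^ depth A)"
            using \<open>t \<ge> 1\<close> by (intro add_right_mono self_le_power) auto
          also have "\<dots> \<le> (KA + 1 + KB) * t ^ (depth A + 1)"
            by (simp add: algebra_simps)
          finally show ?thesis .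
        qed
        also have "\<dots> \<le> (KA + 1 + KB) * t ^ depth H"
          using power[of "depth A + 1"] depth by (intro mult_left_mono) auto
        finally show ?thesis by simp
      qed
      have "h - l \<le> 2 * min (m - l) (h - m) + 1" "l < m \<or> h - l \<le> 1"
        by (auto simp: m_def)
      moreover have "1 \<le> t ^ depth H" using \<open>t \<ge> 1\<close> by simp
      ultimately have "h - l \<le> 2 * ((KA + 1 + KB) * t ^ depth H) + t ^ depth H"
        using half by fastforce
      then show "h - l \<le> K * t ^ depth H" by (simp add: K_def algebra_simps)
    qed
    then show ?thesis by blast
  qed
qed

section \<open>From the bound to \<open>g\<close>\<close>

text \<open>All edges of this graph lie on its Hamiltonian path, so it avoids every pattern with an
  edge and caps the maximum in \<open>g\<close> at \<open>n\<close>.\<close>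

lemma path_graph_exists:
  assumes "n > 0"
  obtains G :: "(nat, nat \<times> nat) pre_digraph"
  where "graph G" "hamiltonian_path G [0..<n]" "verts G = {..<n}"
    "arcs_ends G = path_edges [0..<n]"
proof -
  define E where "E = path_edges [0..<n]"
  define G :: "(nat, nat \<times> nat) pre_digraph"
    where "G = \<lparr>verts = {..<n}, arcs = E, tail = fst, head = snd\<rparr>"
  have E: "(i, j) \<in> E \<longleftrightarrow> i < n \<and> j < n \<and> (j = Suc i \<or> i = Suc j)" for i j
    by (auto simp: E_def path_edges_def set_vwalk_arcs_conv_nth cong: rev_conj_cong)
  have ends: "arcs_ends G = E" by (auto simp: arcs_ends_conv G_def)
  have "finite E" by (rule finite_subset[of _ "{..<n} \<times> {..<n}"]) (auto simp: E)
  then have "graph G"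
    by unfold_locales
      (auto simp: G_def E arc_to_ends_def symmetric_def sym_def arcs_ends_conv image_iff)
  moreover have "hamiltonian_path G [0..<n]"
    using assms ends
    by (auto simp: hamiltonian_path_def vpath_def vwalk_def E_def path_edges_def G_def)
  ultimately show thesis
    using that ends by (simp add: E_def G_def)
qed

text \<open>The bare path on \<open>n\<close> vertices bounds the admissible values, so
  \<open>GREATEST\<close> is a true upper bound for them. Hence \<open>Suc (g H n)\<close> is not
  admissible, and a graph refuting it is the one wanted.\<close>

lemma g_bound_attained:
  fixes H :: "('c::linorder, 'd) pre_digraph"
  assumes "u \<rightarrow>\<^bsub>H\<^esub> v" "n > 0"
  obtains G :: "(nat, nat \<times> nat) pre_digraph" and p
  where "graph G" "hamiltonian_path G p" "card (verts G) = n" "\<not> contains_pattern G p H"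
    "\<And>q. induced_path G q \<Longrightarrow> length q \<le> g H n"
proof -
  define P where "P t \<longleftrightarrow> (\<forall>(G :: (nat, nat \<times> nat) pre_digraph) p.
     graph G \<and> hamiltonian_path G p \<and> card (verts G) = n \<and> \<not> contains_pattern G p H \<longrightarrow>
     (\<exists>q. induced_path G q \<and> length q \<ge> t))" for t
  have bounded: "t \<le> n" if t: "P t" for t
  proof -
    obtain G :: "(nat, nat \<times> nat) pre_digraph"
      where G: "graph G" "hamiltonian_path G [0..<n]" "verts G = {..<n}"
        "arcs_ends G = path_edges [0..<n]"
      using path_graph_exists[OF assms(2)] by blast
    moreover have "\<not> contains_pattern G [0..<n] H"
      using assms(1) G(4) by (auto simp: contains_pattern_def)
    ultimately obtain q where q: "induced_path G q" "t \<le> length q"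
      using t unfolding P_def by (metis card_lessThan)
    then have "distinct q" "set q \<subseteq> {..<n}"
      using G(3) by (auto simp: induced_path_def vpath_def vwalk_def)
    then have "length q \<le> n"
      using card_mono[of "{..<n}" "set q"] by (simp add: distinct_card)
    with q show ?thesis by simp
  qed
  have "g H n = Greatest P" unfolding g_def P_def ..
  moreover have "t \<le> Greatest P" if "P t" for t
    using Greatest_le_nat[of P t n] that bounded by blast
  ultimately have "\<not> P (Suc (g H n))" by fastforce
  then show thesis
    unfolding P_def using that by (metis not_less_eq_eq)
qed

theorem theorem5:
  fixes H :: "('a::linorder, 'b) pre_digraph"
  assumes "perfect_matching H"
    and "non_crossing H"
    and "verts H \<noteq> {}"
  shows "(\<lambda>n. real (g H n)) \<in> \<Omega>(\<lambda>n. real n powr (1 / real (depth H)))"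
proof -
  have "finite (verts H)"
    using assms(1) by (simp add: perfect_matching_def graph_def digraph_def fin_digraph.finite_verts)
  with assms(3) have d: "depth H > 0"
    by (subst depth.simps) (simp add: Let_def)
  obtain u v where uv: "u \<rightarrow>\<^bsub>H\<^esub> v"
    using assms(3) perfect_matching_ex1[OF assms(1)] by blast
  obtain K where K: "\<And>G :: (nat, nat \<times> nat) pre_digraph. graph G \<Longrightarrow> avoidance_bound H K G"
    using avoidance_bound_exists[OF assms(1,2)] by blast
  \<comment> \<open>The constant comes from solving \<open>n \<le> (K + 1) * g H n ^ depth H\<close>
    for \<open>g H n\<close>; \<open>K + 1\<close> replaces \<open>K\<close>, which may be 0, in the
    denominator.\<close>
  define c where "c = (1 / real (K + 1)) powr (1 / real (depth H))"
  have "c * real n powr (1 / real (depth H)) \<le> real (g H n)" if n: "n > 0" for n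
  proof -
    obtain G :: "(nat, nat \<times> nat) pre_digraph" and p
      where G: "graph G" "hamiltonian_path G p" "card (verts G) = n" "\<not> contains_pattern G p H"
        and t: "\<And>q. induced_path G q \<Longrightarrow> length q \<le> g H n"
      using g_bound_attained[OF uv n] by blast
    then have p: "vpath p G" "length p = n"
      by (auto simp: hamiltonian_path_def vpath_def distinct_card[symmetric])
    have "length p - 0 \<le> K * g H n ^ depth H"
      using K[OF G(1)] p t G(4)
      unfolding avoidance_bound_def contains_pattern_conv_between by blast
    with p have "n \<le> K * g H n ^ depth H" by simp
    also have "\<dots> \<le> (K + 1) * g H n ^ depth H" by simp
    finally have le: "real n \<le> real (K + 1) * real (g H n) ^ depth H"
      by (metis of_nat_le_iff of_nat_mult of_nat_power)
    \<comment> \<open>If \<open>g H n\<close> were 0, the positive exponent would force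
      \<open>n = 0\<close>. Positivity is used when the power is rewritten with
      \<open>powr\<close>.\<close>
    then have gpos: "g H n > 0" using n d by (cases "g H n") (simp_all add: zero_power)
    have "c * real n powr (1 / real (depth H)) = (real n / real (K + 1)) powr (1 / real (depth H))"
      unfolding c_def by (simp add: powr_mult[symmetric])
    also have "\<dots> \<le> (real (g H n) ^ depth H) powr (1 / real (depth H))"
      using le by (intro powr_mono2) (auto simp: field_simps)
    also have "\<dots> = real (g H n)"
      using gpos d by (simp add: powr_realpow[symmetric] powr_powr)
    finally show ?thesis .
  qed
  moreover have "c > 0" by (simp add: c_def)
  ultimately show ?thesis
    unfolding bigomega_def
    by (auto intro!: exI[of _ c] eventually_mono[OF eventually_gt_at_top[of 0]])
qed

end
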